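(* Let $\Phi$ be the real affine root system of type $D_{n+1}^{(2)}$. For every $I\subsetneq I_n=\{1,\dots,n\}$, the set $\Psi_I(D_{n+1}^{(2)})$ is a maximal closed subroot system of $\Phi$. The type of $\Psi_I(D_{n+1}^{(2)})$ is $B_r^{(1)}\oplus B_{n-r}^{(1)}$, where $|I|=r$.
   Context: $n\ge2$; $\epsilon_1,\dots,\epsilon_n$ are orthonormal and $\delta$ is a vector linearly independent of them with $(\delta,\cdot)=0$. $$\Phi=\{\pm\epsilon_i+r\delta,\ \pm\epsilon_i\pm\epsilon_j+2r\delta:r\in\mathbb Z,\ 1\le i\ne j\le n\}.$$ For $I\subseteq I_n$, $$\Psi_I(D_{n+1}^{(2)})=\{\pm\epsilon_s+2r\delta:s\in I\}\cup\{\pm\epsilon_s+(2r+1)\delta:s\notin I\}\cup\{\pm\epsilon_s\pm\epsilon_t+2r\delta:s\ne t,\ s,t\in I\text{ or }s,t\notin I\},$$ with $r$ ranging over $\mathbb Z$. With $\langle\beta,\alpha^\vee\rangle=2(\beta,\alpha)/(\alpha,\alpha)$ and $\mathbf s_\alpha(\beta)=\beta-\langle\beta,\alpha^\vee\rangle\alpha$, a non-empty subset $\Psi$ of $\Phi$ is a subroot system if $\mathbf s_\alpha(\beta)\in\Psi$ for all $\alpha,\beta\in\Psi$; it is closed if $\alpha,\beta\in\Psi$, $\alpha+\beta\in\Phi$ imply $\alpha+\beta\in\Psi$. A maximal closed subroot system of $\Phi$ is a proper closed subroot system $\Psi$ such that $\Psi\subseteq\Delta\subsetneq\Phi$ with $\Delta$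 a closed subroot system implies $\Delta=\Psi$. Type: an irreducible subroot system $\Psi$ is of type $X_k^{(t)}$ if there is a linear isomorphism from the real span of $\Psi$ onto the real span of the real affine root system of type $X_k^{(t)}$ mapping $\Psi$ onto it and preserving the integers $\langle\beta,\alpha^\vee\rangle$; a reducible one has type $\bigoplus_i X_{k_i}^{(t_i)}$ if it is the union of mutually orthogonal irreducible components of types $X_{k_i}^{(t_i)}$. The real roots of type $B_k^{(1)}$ are $\{\alpha+r\delta:\alpha\in B_k,r\in\mathbb Z\}$; conventions: $B_1^{(1)}=A_1^{(1)}$, and a $B_0^{(1)}$ summand is absent. *)

theory Defs
  imports "HOL-Analysis.Analysis"
begin

text \<open>
  Everything takes place in a real vector space with a symmetric bilinear form \<open>form\<close>, which may
  be degenerate.  The vectors \<open>\<epsilon> 1, \<dots>, \<epsilon> n\<close> are orthonormal for it and \<open>\<delta>\<close> lies in its radical.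
\<close>

definition affine_frame ::
    "('v::real_vector \<Rightarrow> 'v \<Rightarrow> real) \<Rightarrow> nat \<Rightarrow> (nat \<Rightarrow> 'v) \<Rightarrow> 'v \<Rightarrow> bool" where
  "affine_frame form n \<epsilon> \<delta> \<longleftrightarrow>
     bilinear form \<and> (\<forall>x y. form x y = form y x) \<and>
     (\<forall>i\<in>{1..n}. \<forall>j\<in>{1..n}. form (\<epsilon> i) (\<epsilon> j) = (if i = j then 1 else 0)) \<and>
     (\<forall>x. form \<delta> x = 0) \<and>
     \<delta> \<notin> span (\<epsilon> ` {1..n})"

definition cartan_int :: "('v::real_vector \<Rightarrow> 'v \<Rightarrow> real) \<Rightarrow> 'v \<Rightarrow> 'v \<Rightarrow> real" where
  "cartan_int form \<beta> \<alpha> = 2 * form \<beta> \<alpha> / form \<alpha> \<alpha>"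

definition refl_along :: "('v::real_vector \<Rightarrow> 'v \<Rightarrow> real) \<Rightarrow> 'v \<Rightarrow> 'v \<Rightarrow> 'v" where
  "refl_along form \<alpha> \<beta> = \<beta> - cartan_int form \<beta> \<alpha> *\<^sub>R \<alpha>"

definition subroot_system ::
    "('v::real_vector \<Rightarrow> 'v \<Rightarrow> real) \<Rightarrow> 'v set \<Rightarrow> 'v set \<Rightarrow> bool" where
  "subroot_system form \<Phi> \<Psi> \<longleftrightarrow>
     \<Psi> \<noteq> {} \<and> \<Psi> \<subseteq> \<Phi> \<and> (\<forall>\<alpha>\<in>\<Psi>. \<forall>\<beta>\<in>\<Psi>. refl_along form \<alpha> \<beta> \<in> \<Psi>)"

definition closed_subroot_system ::
    "('v::real_vector \<Rightarrow> 'v \<Rightarrow> real) \<Rightarrow> 'v set \<Rightarrow> 'v set \<Rightarrow> bool" where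
  "closed_subroot_system form \<Phi> \<Psi> \<longleftrightarrow>
     subroot_system form \<Phi> \<Psi> \<and> (\<forall>\<alpha>\<in>\<Psi>. \<forall>\<beta>\<in>\<Psi>. \<alpha> + \<beta> \<in> \<Phi> \<longrightarrow> \<alpha> + \<beta> \<in> \<Psi>)"

definition maximal_closed_subroot_system ::
    "('v::real_vector \<Rightarrow> 'v \<Rightarrow> real) \<Rightarrow> 'v set \<Rightarrow> 'v set \<Rightarrow> bool" where
  "maximal_closed_subroot_system form \<Phi> \<Psi> \<longleftrightarrow>
     closed_subroot_system form \<Phi> \<Psi> \<and> \<Psi> \<noteq> \<Phi> \<and>
     (\<forall>\<Delta>. closed_subroot_system form \<Phi> \<Delta> \<and> \<Psi> \<subseteq> \<Delta> \<and> \<Delta> \<subset> \<Phi> \<longrightarrow> \<Delta> = \<Psi>)"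

definition orthogonal_sets ::
    "('v::real_vector \<Rightarrow> 'v \<Rightarrow> real) \<Rightarrow> 'v set \<Rightarrow> 'v set \<Rightarrow> bool" where
  "orthogonal_sets form A B \<longleftrightarrow> (\<forall>\<alpha>\<in>A. \<forall>\<beta>\<in>B. form \<alpha> \<beta> = 0)"

definition irreducible_subroot_system ::
    "('v::real_vector \<Rightarrow> 'v \<Rightarrow> real) \<Rightarrow> 'v set \<Rightarrow> 'v set \<Rightarrow> bool" where
  "irreducible_subroot_system form \<Phi> \<Psi> \<longleftrightarrow>
     subroot_system form \<Phi> \<Psi> \<and>
     \<not> (\<exists>A B. A \<noteq> {} \<and> B \<noteq> {} \<and> \<Psi> = A \<union> B \<and> orthogonal_sets form A B)"

text \<open>
  Isomorphism of \<open>\<Psi>\<close> with a model root system \<open>R\<close>.  Only the values of \<open>f\<close> on the span of \<open>\<Psi>\<close>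
  matter, so linearity is required there only.
\<close>

definition root_iso :: "('v::real_vector \<Rightarrow> 'v \<Rightarrow> real) \<Rightarrow> 'v set \<Rightarrow>
    ('w::real_vector \<Rightarrow> 'w \<Rightarrow> real) \<Rightarrow> 'w set \<Rightarrow> bool" where
  "root_iso form \<Psi> form' R \<longleftrightarrow>
     (\<exists>f. (\<forall>x\<in>span \<Psi>. \<forall>y\<in>span \<Psi>. f (x + y) = f x + f y) \<and>
          (\<forall>c. \<forall>x\<in>span \<Psi>. f (c *\<^sub>R x) = c *\<^sub>R f x) \<and>
          bij_betw f (span \<Psi>) (span R) \<and>
          f ` \<Psi> = R \<and>
          (\<forall>\<alpha>\<in>\<Psi>. \<forall>\<beta>\<in>\<Psi>. cartan_int form' (f \<beta>) (f \<alpha>) = cartan_int form \<beta> \<alpha>))"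

text \<open>
  \<open>\<Psi>\<close> has as its type the direct sum of the types of the model root systems in the list \<open>Rs\<close>: it
  is the union of mutually orthogonal irreducible subroot systems, one for each entry of \<open>Rs\<close>.
  For a one-element list this is the type of an irreducible \<open>\<Psi>\<close>.
\<close>

definition has_type :: "('v::real_vector \<Rightarrow> 'v \<Rightarrow> real) \<Rightarrow> 'v set \<Rightarrow> 'v set \<Rightarrow>
    ('w::real_vector \<Rightarrow> 'w \<Rightarrow> real) \<Rightarrow> 'w set list \<Rightarrow> bool" where
  "has_type form \<Phi> \<Psi> form' Rs \<longleftrightarrow>
     (\<exists>Cs. length Cs = length Rs \<and> \<Psi> = \<Union> (set Cs) \<and>
        (\<forall>i<length Cs. irreducible_subroot_system form \<Phi> (Cs ! i) \<and>
                       root_iso form (Cs ! i) form' (Rs ! i)) \<and>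
        (\<forall>i<length Cs. \<forall>j<length Cs. i \<noteq> j \<longrightarrow> orthogonal_sets form (Cs ! i) (Cs ! j)))"

definition B_fin :: "(nat \<Rightarrow> 'v::real_vector) \<Rightarrow> nat \<Rightarrow> 'v set" where
  "B_fin \<epsilon> k =
     {a *\<^sub>R \<epsilon> i |a i. a \<in> {1, -1} \<and> i \<in> {1..k}} \<union>
     {a *\<^sub>R \<epsilon> i + b *\<^sub>R \<epsilon> j |a b i j.
        a \<in> {1, -1} \<and> b \<in> {1, -1} \<and> i \<in> {1..k} \<and> j \<in> {1..k} \<and> i \<noteq> j}"

text \<open>
  The real roots of type \<open>B\<close> (untwisted affine) of rank \<open>k\<close>.  For \<open>k = 1\<close> the finite part is
  \<open>{\<epsilon> 1, - \<epsilon> 1}\<close>, a root system of type \<open>A\<close> of rank one.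
\<close>

definition B_aff :: "(nat \<Rightarrow> 'v::real_vector) \<Rightarrow> 'v \<Rightarrow> nat \<Rightarrow> 'v set" where
  "B_aff \<epsilon> \<delta> k = {\<alpha> + real_of_int r *\<^sub>R \<delta> |\<alpha> r. \<alpha> \<in> B_fin \<epsilon> k}"

text \<open>The type \<open>\<Oplus>\<close> of the \<open>B_aff\<close> of the ranks in \<open>ks\<close>; rank-zero summands are absent.\<close>

definition has_B_aff_type :: "('v::real_vector \<Rightarrow> 'v \<Rightarrow> real) \<Rightarrow> (nat \<Rightarrow> 'v) \<Rightarrow> 'v \<Rightarrow>
    'v set \<Rightarrow> 'v set \<Rightarrow> nat list \<Rightarrow> bool" where
  "has_B_aff_type form \<epsilon> \<delta> \<Phi> \<Psi> ks \<longleftrightarrow>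
     has_type form \<Phi> \<Psi> form (map (B_aff \<epsilon> \<delta>) (filter (\<lambda>k. k \<noteq> 0) ks))"

text \<open>The real roots of type \<open>D\<^sub>n\<^sub>+\<^sub>1\<^sup>(\<^sup>2\<^sup>)\<close>.\<close>

definition D_tw :: "(nat \<Rightarrow> 'v::real_vector) \<Rightarrow> 'v \<Rightarrow> nat \<Rightarrow> 'v set" where
  "D_tw \<epsilon> \<delta> n =
     {a *\<^sub>R \<epsilon> i + real_of_int r *\<^sub>R \<delta> |a i r. a \<in> {1, -1} \<and> i \<in> {1..n}} \<union>
     {a *\<^sub>R \<epsilon> i + b *\<^sub>R \<epsilon> j + real_of_int (2 * r) *\<^sub>R \<delta> |a b i j r.
        a \<in> {1, -1} \<and> b \<in> {1, -1} \<and> i \<in> {1..n} \<and> j \<in> {1..n} \<and> i \<noteq> j}"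

definition Psi_D_tw :: "(nat \<Rightarrow> 'v::real_vector) \<Rightarrow> 'v \<Rightarrow> nat \<Rightarrow> nat set \<Rightarrow> 'v set" where
  "Psi_D_tw \<epsilon> \<delta> n I =
     {a *\<^sub>R \<epsilon> s + real_of_int (2 * r) *\<^sub>R \<delta> |a s r. a \<in> {1, -1} \<and> s \<in> I} \<union>
     {a *\<^sub>R \<epsilon> s + real_of_int (2 * r + 1) *\<^sub>R \<delta> |a s r. a \<in> {1, -1} \<and> s \<in> {1..n} - I} \<union>
     {a *\<^sub>R \<epsilon> s + b *\<^sub>R \<epsilon> t + real_of_int (2 * r) *\<^sub>R \<delta> |a b s t r.
        a \<in> {1, -1} \<and> b \<in> {1, -1} \<and> s \<noteq> t \<and>
        (s \<in> I \<and> t \<in> I \<or> s \<in> {1..n} - I \<and> t \<in> {1..n} - I)}"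

end

theory Submission
  imports Defs
begin

text \<open>
  Give a vector \<open>\<Sum> x\<^sub>i \<epsilon>\<^sub>i + c \<delta>\<close> with integer coefficients the coordinates \<open>(x, c)\<close>.  The roots
  of \<open>\<Phi>\<close> are then exactly the vectors with \<open>x \<bullet> x = 1\<close>, or with \<open>x \<bullet> x = 2\<close> and \<open>c\<close> even
  (\<open>D_tw_coords\<close>).  Let \<open>p\<close> be the indicator function of the complement of \<open>I\<close>.  The set \<open>\<Psi>\<^sub>I\<close>
  consists of the roots on which the homomorphism \<open>(x, c) \<mapsto> c - p \<bullet> x\<close> to \<open>\<int>/2\<close> vanishes
  (\<open>Psi_D_tw_eq_parity_roots\<close>).  Closedness under sums is then clear.  A reflection subtracts an
  integer multiple of one root from another and preserves \<open>\<Phi>\<close>, so it preserves the kernel as well.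

  For maximality, call a root wrong if the homomorphism does not vanish on it, and let \<open>\<Delta>\<close> be
  closed with \<open>\<Psi>\<^sub>I \<subset> \<Delta>\<close>.  It contains a wrong root, and adding a short root of \<open>\<Psi>\<^sub>I\<close> if
  necessary, a wrong short root along some \<open>\<epsilon>\<^sub>s\<close>.  Adding roots of \<open>\<Psi>\<^sub>I\<close> to it produces every wrong
  short root along every \<open>\<epsilon>\<^sub>t\<close> with \<open>t \<noteq> s\<close>; as \<open>n \<ge> 2\<close>, returning from such a \<open>t\<close> to \<open>s\<close> gives the
  remaining ones.  So \<open>\<Delta>\<close> contains all short roots, and each long root is a sum of two of them
  (\<open>parity_roots_maximal\<close>).

  For the type, a long root of \<open>\<Psi>\<^sub>I\<close> has both its indices in \<open>I\<close> or both outside, so \<open>\<Psi>\<^sub>I\<close> is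
  the orthogonal union of its parts supported in \<open>I\<close> and in the complement (\<open>parity_roots_split\<close>).
  On each part \<open>p\<close> has a constant value \<open>q\<close>, and the vectors \<open>\<epsilon>\<^sub>s + q \<delta>\<close> together with the null
  vector \<open>2 \<delta>\<close> form a frame in whose terms the part is literally the standard real root system of
  type \<open>B\<close> (\<open>parity_roots_eq_B_aff\<close>).  Any two such systems of equal rank are isomorphic
  (\<open>root_iso_B_aff\<close>), and they are irreducible in positive rank (\<open>B_aff_indecomposable\<close>).
\<close>

section \<open>Integer vectors of norm one and two\<close>

definition single :: "nat \<Rightarrow> int \<Rightarrow> nat \<Rightarrow> int" where
  "single s a = (\<lambda>i. if i = s then a else 0)"

lemma sum_single_mult:
  "finite N \<Longrightarrow> s \<in> N \<Longrightarrow> (\<Sum>i\<in>N. single s a i * y i) = a * y s"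
  by (simp add: single_def if_distrib [of "\<lambda>u. u * _"] cong: if_cong)

abbreviation pair :: "nat \<Rightarrow> int \<Rightarrow> nat \<Rightarrow> int \<Rightarrow> nat \<Rightarrow> int" where
  "pair s a t b \<equiv> (\<lambda>i. single s a i + single t b i)"

text \<open>Signs are real scalars in the root systems, whereas coordinates are integers.\<close>

lemma real_sign_int:
  assumes "a \<in> {1, -1 :: real}"
  obtains a' :: int where "a = real_of_int a'" "a' \<in> {1, -1}"
proof (cases "a = 1")
  case True
  then show ?thesis using that [of 1] by simp
next
  case False
  then show ?thesis using that [of "-1"] assms by simp
qed

lemma square_le_two_int:
  fixes a :: int
  assumes "a \<noteq> 0" "a * a \<le> 2"
  shows "a \<in> {1, -1}"
proof -
  have "\<bar>a\<bar> < 2"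
  proof (rule ccontr)
    assume "\<not> \<bar>a\<bar> < 2"
    then have "2 * 2 \<le> \<bar>a\<bar> * \<bar>a\<bar>" by (intro mult_mono) auto
    with assms show False by (simp add: abs_mult_self_eq)
  qed
  with assms show ?thesis by auto
qed

text \<open>
  A sum of squares equal to 1 or 2 has a nonzero entry, which can only be a sign.  Splitting it off
  lowers the sum by one, which drives the classification of vectors of norm 1 and 2.
\<close>

lemma sum_squares_split:
  fixes x :: "nat \<Rightarrow> int"
  assumes "finite N" "(\<Sum>i\<in>N. x i * x i) \<in> {1, 2}"
  obtains s where "s \<in> N" "x s \<in> {1, -1}"
    "(\<Sum>i\<in>N - {s}. x i * x i) = (\<Sum>i\<in>N. x i * x i) - 1"
proof -
  from assms(2) have "(\<Sum>i\<in>N. x i * x i) \<noteq> 0" by auto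
  then obtain s where s: "s \<in> N" "x s * x s \<noteq> 0"
    by (meson sum.not_neutral_contains_not_neutral)
  have split: "(\<Sum>i\<in>N. x i * x i) = x s * x s + (\<Sum>i\<in>N - {s}. x i * x i)"
    using assms(1) s(1) by (rule sum.remove)
  have "0 \<le> (\<Sum>i\<in>N - {s}. x i * x i)" by (intro sum_nonneg) simp
  with split assms(2) have "x s * x s \<le> 2" by auto
  with s have "x s \<in> {1, -1}" by (intro square_le_two_int) auto
  with that s split show ?thesis by force
qed

lemma norm_one_single:
  fixes x :: "nat \<Rightarrow> int"
  assumes "finite N" "(\<Sum>i\<in>N. x i * x i) = 1"
  obtains s a where "s \<in> N" "a \<in> {1, -1}" "\<And>i. i \<in> N \<Longrightarrow> x i = single s a i"
proof -
  from assms obtain s where s: "s \<in> N" "x s \<in> {1, -1}" "(\<Sum>i\<in>N - {s}. x i * x i) = 0"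
    by (metis diff_self insertI1 sum_squares_split)
  then have "\<forall>i\<in>N - {s}. x i * x i = 0"
    using assms(1) by (subst (asm) sum_nonneg_eq_0_iff) auto
  with s show ?thesis by (intro that [of s "x s"]) (auto simp: single_def)
qed

lemma norm_two_pair:
  fixes x :: "nat \<Rightarrow> int"
  assumes "finite N" "(\<Sum>i\<in>N. x i * x i) = 2"
  obtains s t a b where "s \<in> N" "t \<in> N" "s \<noteq> t" "a \<in> {1, -1}" "b \<in> {1, -1}"
    "\<And>i. i \<in> N \<Longrightarrow> x i = single s a i + single t b i"
proof -
  from assms obtain s where s: "s \<in> N" "x s \<in> {1, -1}" "(\<Sum>i\<in>N - {s}. x i * x i) = 1"
    by (elim sum_squares_split [of N x]) auto
  from assms(1) have "finite (N - {s})" by simp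
  from this s(3) obtain t b where t: "t \<in> N - {s}" "b \<in> {1, -1}"
    "\<And>i. i \<in> N - {s} \<Longrightarrow> x i = single t b i"
    by (rule norm_one_single) blast
  show ?thesis
  proof (rule that [of s t "x s" b])
    fix i assume "i \<in> N"
    with t show "x i = single s (x s) i + single t b i"
      by (cases "i = s") (auto simp: single_def)
  qed (use s t in auto)
qed

section \<open>Frames and the model systems of type B\<close>

lemma affine_frame_form_simps:
  assumes "affine_frame form n e d"
  shows "form (x + y) z = form x z + form y z" "form z (x + y) = form z x + form z y"
    "form (c *\<^sub>R x) z = c * form x z" "form z (c *\<^sub>R x) = c * form z x"
    "form d z = 0" "form z d = 0"
    "i \<in> {1..n} \<Longrightarrow> j \<in> {1..n} \<Longrightarrow> form (e i) (e j) = (if i = j then 1 else 0)"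
  using assms unfolding affine_frame_def
  by (auto simp: bilinear_ladd bilinear_radd bilinear_lmul bilinear_rmul)

text \<open>
  The form is nondegenerate on the span of orthonormal vectors: there \<open>x = \<Sum> (x, e\<^sub>i) e\<^sub>i\<close>, because
  both sides are linear and agree on each \<open>e\<^sub>j\<close>.
\<close>

lemma orthonormal_null_in_span:
  fixes form :: "'v::real_vector \<Rightarrow> 'v \<Rightarrow> real" and e :: "nat \<Rightarrow> 'v"
  assumes bil: "bilinear form"
    and orth: "\<And>i j. i \<in> K \<Longrightarrow> j \<in> K \<Longrightarrow> form (e i) (e j) = (if i = j then 1 else 0)"
    and "finite K" "x \<in> span (e ` K)" and null: "\<And>i. i \<in> K \<Longrightarrow> form x (e i) = 0"
  shows "x = 0"
proof -
  have lin: "linear (\<lambda>y. form y z)" for z using bil by (simp add: bilinear_def)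
  have "linear (\<lambda>y. \<Sum>i\<in>K. form y (e i) *\<^sub>R e i)"
    by (rule linearI)
      (simp_all add: linear_add [OF lin] linear_scale [OF lin] scaleR_add_left sum.distrib
        scaleR_sum_right)
  then have "(\<Sum>i\<in>K. form x (e i) *\<^sub>R e i) = id x"
  proof (rule linear_eq_on_span [OF _ linear_id _ \<open>x \<in> span (e ` K)\<close>])
    fix y assume "y \<in> e ` K"
    then obtain j where j: "j \<in> K" "y = e j" by auto
    then have "(\<Sum>i\<in>K. form y (e i) *\<^sub>R e i) = (\<Sum>i\<in>K. if i = j then e j else 0)"
      by (intro sum.cong) (auto simp: orth)
    with j \<open>finite K\<close> show "(\<Sum>i\<in>K. form y (e i) *\<^sub>R e i) = id y" by simp
  qed
  with null show ?thesis by simp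
qed

text \<open>
  Adding null vectors does not change the form, so orthonormality survives the shift by multiples
  of \<open>\<delta>\<close>.  The null vector stays outside the span of the shifted vectors because only \<open>0\<close> is
  orthogonal to the whole span of an orthonormal family.
\<close>

lemma affine_frame_rebase:
  assumes frame: "affine_frame form n \<epsilon> \<delta>" and bij: "bij_betw \<pi> {1..k} J" and "J \<subseteq> {1..n}"
    and "c \<noteq> 0"
  shows "affine_frame form k (\<lambda>i. \<epsilon> (\<pi> i) + q *\<^sub>R \<delta>) (c *\<^sub>R \<delta>)"
proof -
  note [simp] = affine_frame_form_simps [OF frame]
  have bil: "bilinear form" "form x y = form y x" for x y
    using frame by (auto simp: affine_frame_def)
  have in_n: "\<pi> i \<in> {1..n}" if "i \<in> {1..k}" for i
    using \<open>J \<subseteq> {1..n}\<close> bij_betw_apply [OF bij that] by (rule subsetD)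
  have inj: "\<pi> i = \<pi> j \<longleftrightarrow> i = j" if "i \<in> {1..k}" "j \<in> {1..k}" for i j
    using bij_betw_imp_inj_on [OF bij] that by (rule inj_on_eq_iff)
  have orth: "form (\<epsilon> (\<pi> i) + q *\<^sub>R \<delta>) (\<epsilon> (\<pi> j) + q *\<^sub>R \<delta>) = (if i = j then 1 else 0)"
    if "i \<in> {1..k}" "j \<in> {1..k}" for i j
    using in_n [OF that(1)] in_n [OF that(2)] inj [OF that] by simp
  have "\<delta> \<noteq> 0" using frame by (auto simp: affine_frame_def span_zero)
  have "c *\<^sub>R \<delta> \<notin> span ((\<lambda>i. \<epsilon> (\<pi> i) + q *\<^sub>R \<delta>) ` {1..k})"
  proof
    assume "c *\<^sub>R \<delta> \<in> span ((\<lambda>i. \<epsilon> (\<pi> i) + q *\<^sub>R \<delta>) ` {1..k})"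
    with bil(1) orth finite_atLeastAtMost have "c *\<^sub>R \<delta> = 0"
      by (rule orthonormal_null_in_span) simp_all
    with \<open>\<delta> \<noteq> 0\<close> \<open>c \<noteq> 0\<close> show False by simp
  qed
  moreover have "form (c *\<^sub>R \<delta>) x = 0" for x by simp
  ultimately show ?thesis
    unfolding affine_frame_def using bil orth by (intro conjI allI ballI)
qed

lemma affine_frame_independent:
  assumes frame: "affine_frame form k e d"
  shows "independent (insert d (e ` {1..k}))" "inj_on e {1..k}" "d \<notin> e ` {1..k}"
proof -
  note [simp] = affine_frame_form_simps [OF frame]
  have lin: "linear (\<lambda>y. form y z)" for z
    using frame by (simp add: affine_frame_def bilinear_def)
  have nspan: "d \<notin> span (e ` {1..k})" using frame by (simp add: affine_frame_def)
  show "d \<notin> e ` {1..k}"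
  proof
    assume "d \<in> e ` {1..k}"
    from span_base [OF this] nspan show False by contradiction
  qed
  show inj: "inj_on e {1..k}"
  proof (rule inj_onI, rule ccontr)
    fix i j assume ij: "i \<in> {1..k}" "j \<in> {1..k}" "e i = e j" "i \<noteq> j"
    then have "form (e i) (e i) = form (e i) (e j)" by simp
    also have "\<dots> = 0" using ij(1,2,4) by simp
    finally show False using ij(1) by simp
  qed
  have "independent (e ` {1..k})"
    unfolding dependent_def
  proof safe
    fix j assume j: "j \<in> {1..k}" "e j \<in> span (e ` {1..k} - {e j})"
    have "form (e j) (e j) = 0"
    proof (rule linear_eq_0_on_span [OF lin _ j(2)])
      fix x assume "x \<in> e ` {1..k} - {e j}"
      then obtain i where "i \<in> {1..k}" "x = e i" "i \<noteq> j" by blast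
      with j(1) show "form x (e j) = 0" by simp
    qed
    with j(1) show False by simp
  qed
  with nspan show "independent (insert d (e ` {1..k}))" by (simp add: independent_insert)
qed

lemma B_aff_shortI:
  assumes "a \<in> {1, -1}" "i \<in> {1..k}"
  shows "a *\<^sub>R e i + real_of_int r *\<^sub>R d \<in> B_aff e d k"
proof -
  have "a *\<^sub>R e i \<in> B_fin e k" unfolding B_fin_def using assms by blast
  then show ?thesis unfolding B_aff_def by blast
qed

lemma B_aff_longI:
  assumes "a \<in> {1, -1}" "b \<in> {1, -1}" "i \<in> {1..k}" "j \<in> {1..k}" "i \<noteq> j"
  shows "a *\<^sub>R e i + b *\<^sub>R e j + real_of_int r *\<^sub>R d \<in> B_aff e d k"
proof -
  have "a *\<^sub>R e i + b *\<^sub>R e j \<in> B_fin e k" unfolding B_fin_def using assms by blast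
  then show ?thesis unfolding B_aff_def by blast
qed

lemma B_aff_cases:
  assumes "v \<in> B_aff e d k"
  obtains (short) a i r where "a \<in> {1, -1}" "i \<in> {1..k}" "v = a *\<^sub>R e i + real_of_int r *\<^sub>R d"
  | (long) a b i j r where "a \<in> {1, -1}" "b \<in> {1, -1}" "i \<in> {1..k}" "j \<in> {1..k}" "i \<noteq> j"
    "v = a *\<^sub>R e i + b *\<^sub>R e j + real_of_int r *\<^sub>R d"
proof -
  from assms obtain \<alpha> r where v: "v = \<alpha> + real_of_int r *\<^sub>R d" "\<alpha> \<in> B_fin e k"
    unfolding B_aff_def by blast
  from v(2) show ?thesis
    unfolding B_fin_def
    by (elim UnE CollectE exE conjE) (use that v(1) in blast)+
qed

lemma image_B_aff_subset:
  assumes "linear f" "\<And>i. i \<in> {1..k} \<Longrightarrow> f (e i) = e' i" "f d = d'" "v \<in> B_aff e d k"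
  shows "f v \<in> B_aff e' d' k"
  using assms(4)
proof (cases rule: B_aff_cases)
  case (short a i r)
  then show ?thesis
    by (simp only: linear_add [OF assms(1)] linear_scale [OF assms(1)] assms(2,3) B_aff_shortI)
next
  case (long a b i j r)
  show ?thesis
    unfolding long(6) linear_add [OF assms(1)] linear_scale [OF assms(1)] assms(3)
      assms(2) [OF long(3)] assms(2) [OF long(4)]
    using long(1-5) by (rule B_aff_longI)
qed

lemma image_B_aff:
  assumes "linear f" "\<And>i. i \<in> {1..k} \<Longrightarrow> f (e i) = e' i" "f d = d'"
  shows "f ` B_aff e d k = B_aff e' d' k"
proof (intro subset_antisym subsetI)
  fix w assume "w \<in> B_aff e' d' k"
  then show "w \<in> f ` B_aff e d k"
  proof (cases rule: B_aff_cases)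
    case (short a i r)
    then have "w = f (a *\<^sub>R e i + real_of_int r *\<^sub>R d)"
      by (simp only: linear_add [OF assms(1)] linear_scale [OF assms(1)] assms(2,3))
    then show ?thesis using B_aff_shortI [OF short(1,2)] by blast
  next
    case (long a b i j r)
    then have "w = f (a *\<^sub>R e i + b *\<^sub>R e j + real_of_int r *\<^sub>R d)"
      by (simp only: linear_add [OF assms(1)] linear_scale [OF assms(1)] assms(2,3))
    then show ?thesis using B_aff_longI [OF long(1-5)] by blast
  qed
qed (elim imageE, simp only: image_B_aff_subset [OF assms])

lemma B_aff_subset_span: "B_aff e d k \<subseteq> span (insert d (e ` {1..k}))"
proof
  fix v assume "v \<in> B_aff e d k"
  then show "v \<in> span (insert d (e ` {1..k}))"
  proof (cases rule: B_aff_cases)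
    case (short a i r)
    show ?thesis unfolding short(3)
      by (intro span_add span_scale span_base insertI1 insertI2 imageI short(2))
  next
    case (long a b i j r)
    show ?thesis unfolding long(6)
      by (intro span_add span_scale span_base insertI1 insertI2 imageI long(3,4))
  qed
qed

text \<open>
  The vectors of a frame are linearly independent, so sending one frame to another extends to a
  linear map.  It is injective on the span, as the image is again independent, and an isometry, as
  the two forms agree on the frame vectors.
\<close>

lemma root_iso_B_aff:
  assumes frame: "affine_frame form k e d" and frame': "affine_frame form' k e' d'"
  shows "root_iso form (B_aff e d k) form' (B_aff e' d' k)"
proof -
  let ?S = "insert d (e ` {1..k})"
  note ind = affine_frame_independent [OF frame]
  note ind' = affine_frame_independent [OF frame']
  from linear_independent_extend
    [OF ind(1), of "\<lambda>x. if x = d then d' else e' (inv_into {1..k} e x)"]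
  obtain f where lin: "linear f"
    and f: "\<forall>x\<in>?S. f x = (if x = d then d' else e' (inv_into {1..k} e x))"
    by (elim exE conjE)
  have fd: "f d = d'" using f by simp
  have fe: "f (e i) = e' i" if "i \<in> {1..k}" for i
  proof -
    have img: "e i \<in> e ` {1..k}" using that by (rule imageI)
    then have "e i \<noteq> d" using ind(3) by metis
    with bspec [OF f insertI2 [OF img]] inv_into_f_f [OF ind(2) that] show ?thesis
      by (simp only: if_False)
  qed
  have fe_img: "f ` e ` {1..k} = e' ` {1..k}"
    unfolding image_image using fe by (rule image_cong [OF refl])
  have img: "f ` ?S = insert d' (e' ` {1..k})" by (simp only: image_insert fd fe_img)
  have "inj_on f (e ` {1..k})"
  proof (rule inj_onI)
    fix x y assume "x \<in> e ` {1..k}" "y \<in> e ` {1..k}" and eq: "f x = f y"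
    then obtain i j where ij: "i \<in> {1..k}" "j \<in> {1..k}" "x = e i" "y = e j" by (elim imageE)
    with eq fe have "e' i = e' j" by metis
    with ij inj_onD [OF ind'(2)] show "x = y" by metis
  qed
  moreover have "f d \<notin> f ` (e ` {1..k} - {d})"
    by (simp only: Diff_insert0 [OF ind(3)] Diff_empty fe_img fd ind'(3) not_False_eq_True)
  ultimately have inj_S: "inj_on f ?S" unfolding inj_on_insert by (rule conjI)
  have "independent (f ` ?S)" unfolding img by (rule ind'(1))
  with lin have inj: "inj_on f (span ?S)"
    using inj_S by (rule linear_inj_on_span_independent_image)
  have sub: "span (B_aff e d k) \<subseteq> span ?S"
    using B_aff_subset_span subspace_span by (rule span_minimal)
  have onto: "f ` B_aff e d k = B_aff e' d' k"
    using lin fe fd by (rule image_B_aff)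
  have bil: "bilinear form" "bilinear form'"
    using frame frame' by (simp_all add: affine_frame_def)
  have bil': "bilinear (\<lambda>x y. form' (f x) (f y))"
    unfolding bilinear_def
    by (intro conjI allI linearI)
      (simp_all add: linear_add [OF lin] linear_scale [OF lin] bilinear_ladd [OF bil(2)]
        bilinear_radd [OF bil(2)] bilinear_lmul [OF bil(2)] bilinear_rmul [OF bil(2)])
  have basis: "form' (f x) (f y) = form x y" if "x \<in> ?S" "y \<in> ?S" for x y
  proof -
    note fs = affine_frame_form_simps [OF frame] and fs' = affine_frame_form_simps [OF frame']
    show ?thesis
    proof (cases "x = d \<or> y = d")
      case True
      then show ?thesis by (elim disjE) (simp_all only: fd fs(5,6) fs'(5,6))
    next
      case False
      with that have "x \<in> e ` {1..k}" "y \<in> e ` {1..k}" by simp_all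
      then obtain i j where "x = e i" "y = e j" "i \<in> {1..k}" "j \<in> {1..k}" by (elim imageE)
      then show ?thesis by (simp only: fe fs(7) fs'(7))
    qed
  qed
  have isom: "form' (f x) (f y) = form x y" if "x \<in> span ?S" "y \<in> span ?S" for x y
    using bilinear_eq [OF bil' bil(1) subset_refl subset_refl that basis] .
  show ?thesis
    unfolding root_iso_def
  proof (intro exI [of _ f] conjI ballI allI)
    show "bij_betw f (span (B_aff e d k)) (span (B_aff e' d' k))"
      unfolding bij_betw_def
      using inj_on_subset [OF inj sub] linear_span_image [OF lin, of "B_aff e d k"]
      by (simp add: onto)
    show "cartan_int form' (f \<beta>) (f \<alpha>) = cartan_int form \<beta> \<alpha>"
      if "\<alpha> \<in> B_aff e d k" "\<beta> \<in> B_aff e d k" for \<alpha> \<beta>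
      using that [THEN subsetD [OF B_aff_subset_span]] by (simp only: cartan_int_def isom)
  qed (simp_all only: onto linear_add [OF lin] linear_scale [OF lin])
qed

text \<open>
  The short roots \<open>e\<^sub>i\<close> all lie in one part of an orthogonal decomposition, since \<open>e\<^sub>1 + e\<^sub>i\<close> is a
  root that is orthogonal to neither \<open>e\<^sub>1\<close> nor \<open>e\<^sub>i\<close>.  Every root is non-orthogonal to some \<open>e\<^sub>i\<close>,
  so the other part is empty.
\<close>

lemma B_aff_indecomposable:
  assumes frame: "affine_frame form k e d" and "B_aff e d k = A \<union> B"
    and "orthogonal_sets form A B" "A \<noteq> {}"  "B \<noteq> {}"
  shows False
proof -
  note [simp] = affine_frame_form_simps [OF frame]
  have short: "e i \<in> B_aff e d k" if "i \<in> {1..k}" for i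
    using B_aff_shortI [of 1 i k e 0 d] that by simp
  have long: "e i + e j \<in> B_aff e d k" if "i \<in> {1..k}" "j \<in> {1..k}" "i \<noteq> j" for i j
    using B_aff_longI [of 1 1 i k j e 0 d] that by simp
  \<comment> \<open>The decomposition is symmetric in its two parts, so \<open>C\<close> stands for the part containing \<open>e\<^sub>1\<close>.\<close>
  have key: "D = {}" if "B_aff e d k = C \<union> D" "orthogonal_sets form C D" "e 1 \<in> C" "k \<ge> 1" for C D
  proof -
    have linked: "y \<in> C" if "x \<in> C" "y \<in> B_aff e d k" "form x y \<noteq> 0" for x y
      using that \<open>B_aff e d k = C \<union> D\<close> \<open>orthogonal_sets form C D\<close>
      by (auto simp: orthogonal_sets_def)
    have e_in: "e i \<in> C" if "i \<in> {1..k}" for i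
    proof (cases "i = 1")
      case False
      have one: "1 \<in> {1..k}" using \<open>k \<ge> 1\<close> by simp
      have in_C: "e 1 + e i \<in> C"
        by (rule linked [OF \<open>e 1 \<in> C\<close> long]) (use False that one in simp_all)
      show ?thesis
        by (rule linked [OF in_C short]) (use False that one in simp_all)
    qed (use \<open>e 1 \<in> C\<close> in simp)
    have nonorth: "\<exists>i\<in>{1..k}. form (e i) \<beta> \<noteq> 0" if "\<beta> \<in> B_aff e d k" for \<beta>
      using that
    proof (cases rule: B_aff_cases)
      case (short a i r)
      then have "form (e i) \<beta> = a" by simp
      with short show ?thesis by force
    next
      case (long a b i j r)
      then have "form (e i) \<beta> = a" by simp
      with long show ?thesis by force
    qed
    show "D = {}"
    proof (rule equals0I)
      fix \<beta> assume "\<beta> \<in> D"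
      with nonorth that(1) obtain i where "i \<in> {1..k}" "form (e i) \<beta> \<noteq> 0" by blast
      with e_in that(2) \<open>\<beta> \<in> D\<close> show False unfolding orthogonal_sets_def by blast
    qed
  qed
  have "k \<ge> 1"
  proof (rule ccontr)
    assume "\<not> k \<ge> 1"
    then have "B_aff e d k = {}" by (simp add: B_aff_def B_fin_def)
    with assms(2,4) show False by simp
  qed
  moreover from this have "e 1 \<in> A \<union> B" using short [of 1] assms(2) by simp
  moreover have "orthogonal_sets form B A"
    using assms(3) frame unfolding orthogonal_sets_def affine_frame_def by metis
  ultimately show False
    using key [of A B] key [of B A] assms(2-5) by (metis UnE Un_commute)
qed

section \<open>Integral coordinates\<close>

locale affine_frame_coords =
  fixes form :: "'v::real_vector \<Rightarrow> 'v \<Rightarrow> real" and n :: nat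
    and \<epsilon> :: "nat \<Rightarrow> 'v" and \<delta> :: 'v
  assumes frame: "affine_frame form n \<epsilon> \<delta>"
begin

lemmas form_simps = affine_frame_form_simps [OF frame]

definition vec :: "(nat \<Rightarrow> int) \<Rightarrow> int \<Rightarrow> 'v" where
  "vec x c = (\<Sum>i=1..n. real_of_int (x i) *\<^sub>R \<epsilon> i) + real_of_int c *\<^sub>R \<delta>"

definition dot :: "(nat \<Rightarrow> int) \<Rightarrow> (nat \<Rightarrow> int) \<Rightarrow> int" where
  "dot x y = (\<Sum>i=1..n. x i * y i)"

text \<open>
  By \<open>D_tw_coords\<close> below, this is membership in \<open>\<Phi>\<close> in terms of coordinates.  Unlike a list of the
  possible shapes of roots, the norm is visibly invariant under reflections.
\<close>

definition root_coords :: "(nat \<Rightarrow> int) \<Rightarrow> int \<Rightarrow> bool" where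
  "root_coords x c \<longleftrightarrow> dot x x = 1 \<or> dot x x = 2 \<and> even c"

text \<open>
  The kernel of \<open>(x, c) \<mapsto> c - p \<bullet> x\<close> modulo 2 on \<open>\<Phi>\<close>, restricted to the roots supported in \<open>J\<close>.
  For \<open>J = {1..n}\<close> this is a maximal closed subroot system; smaller sets \<open>J\<close> give components of it.
\<close>

definition parity_roots :: "(nat \<Rightarrow> int) \<Rightarrow> nat set \<Rightarrow> 'v set" where
  "parity_roots p J =
     {vec x c |x c. root_coords x c \<and> even (c - dot p x) \<and> (\<forall>i\<in>{1..n} - J. x i = 0)}"

lemma vec_cong: "(\<And>i. i \<in> {1..n} \<Longrightarrow> x i = y i) \<Longrightarrow> vec x c = vec y c"
  by (simp add: vec_def)

lemma vec_add: "vec x c + vec y d = vec (\<lambda>i. x i + y i) (c + d)"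
  by (simp add: vec_def scaleR_add_left sum.distrib)

lemma vec_diff_scaled:
  "vec y d - real_of_int k *\<^sub>R vec x c = vec (\<lambda>i. y i - k * x i) (d - k * c)"
  by (simp add: vec_def scaleR_diff_left scaleR_add_right sum_subtractf scaleR_sum_right)

lemma vec_single: "s \<in> {1..n} \<Longrightarrow> vec (single s a) c = real_of_int a *\<^sub>R \<epsilon> s + real_of_int c *\<^sub>R \<delta>"
  by (simp add: vec_def single_def if_distrib [of "\<lambda>u. real_of_int u *\<^sub>R _"] cong: if_cong)

lemma vec_pair:
  assumes "s \<in> {1..n}" "t \<in> {1..n}"
  shows "vec (\<lambda>i. single s a i + single t b i) c =
    real_of_int a *\<^sub>R \<epsilon> s + real_of_int b *\<^sub>R \<epsilon> t + real_of_int c *\<^sub>R \<delta>"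
  unfolding vec_add [of "single s a" 0 "single t b" c, simplified, symmetric]
  using assms by (simp add: vec_single)

lemma linear_form_right: "linear (form z)"
  using frame by (simp add: affine_frame_def bilinear_def)

lemma linear_form_left: "linear (\<lambda>z. form z w)"
  using frame by (simp add: affine_frame_def bilinear_def)

lemma form_vec_basis: "j \<in> {1..n} \<Longrightarrow> form (vec x c) (\<epsilon> j) = real_of_int (x j)"
  by (simp add: vec_def form_simps linear_sum [OF linear_form_left]
      if_distrib [of "\<lambda>u. _ * u"] del: atLeastAtMost_iff cong: if_cong)

lemma form_vec: "form (vec x c) (vec y d) = real_of_int (dot x y)"
proof -
  have "form (vec x c) (vec y d) = (\<Sum>j=1..n. real_of_int (y j) * form (vec x c) (\<epsilon> j))"
    by (simp add: vec_def [of y] form_simps linear_sum [OF linear_form_right])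
  also have "\<dots> = real_of_int (dot x y)"
    by (simp add: form_vec_basis dot_def mult.commute)
  finally show ?thesis .
qed

text \<open>
  Pairing with \<open>\<epsilon>\<^sub>i\<close> recovers the coefficient of \<open>\<epsilon>\<^sub>i\<close>, after which the coefficient of \<open>\<delta> \<noteq> 0\<close> is
  determined, too.  This makes conditions on coordinates well defined as conditions on vectors.
\<close>

lemma vec_eqD:
  assumes "vec x c = vec y d"
  shows "\<And>i. i \<in> {1..n} \<Longrightarrow> x i = y i" "c = d"
proof -
  show xy: "x i = y i" if "i \<in> {1..n}" for i
    using form_vec_basis [OF that, of x c] form_vec_basis [OF that, of y d] assms by simp
  have "\<delta> \<noteq> 0" using frame by (auto simp: affine_frame_def span_zero)
  have "vec x c = vec y c" using xy by (rule vec_cong)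
  with assms have "vec y c = vec y d" by simp
  then have "real_of_int c *\<^sub>R \<delta> = real_of_int d *\<^sub>R \<delta>" by (simp only: vec_def add_left_cancel)
  with \<open>\<delta> \<noteq> 0\<close> show "c = d" by simp
qed

lemma dot_cong:
  "(\<And>i. i \<in> {1..n} \<Longrightarrow> x i = x' i) \<Longrightarrow> (\<And>i. i \<in> {1..n} \<Longrightarrow> y i = y' i) \<Longrightarrow> dot x y = dot x' y'"
  by (simp add: dot_def)

lemma dot_add: "dot z (\<lambda>i. x i + y i) = dot z x + dot z y"
  by (simp add: dot_def distrib_left sum.distrib)

lemma dot_diff_scaled: "dot z (\<lambda>i. y i - k * x i) = dot z y - k * dot z x"
  by (simp add: dot_def right_diff_distrib sum_subtractf sum_distrib_left mult.left_commute)

lemma dot_commute: "dot x y = dot y x"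
  by (simp add: dot_def mult.commute)

lemma dot_single: "s \<in> {1..n} \<Longrightarrow> dot y (single s a) = a * y s"
  unfolding dot_commute [of y] by (simp add: dot_def sum_single_mult)

lemma root_coords_single: "s \<in> {1..n} \<Longrightarrow> a \<in> {1, -1} \<Longrightarrow> root_coords (single s a) c"
  unfolding root_coords_def by (subst dot_single) (auto simp: single_def)

lemma root_coords_pair:
  assumes "s \<in> {1..n}" "t \<in> {1..n}" "s \<noteq> t" "a \<in> {1, -1}" "b \<in> {1, -1}" "even c"
  shows "root_coords (pair s a t b) c"
proof -
  have "dot (pair s a t b) (pair s a t b) = a * a + b * b"
    using assms(3) by (simp only: dot_add dot_single assms(1,2)) (simp add: single_def)
  with assms show ?thesis unfolding root_coords_def by auto
qed

lemma root_coords_cases: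
  assumes "root_coords x c"
  obtains (short) s a where "s \<in> {1..n}" "a \<in> {1, -1}" "vec x c = vec (single s a) c"
  | (long) s t a b where "s \<in> {1..n}" "t \<in> {1..n}" "s \<noteq> t" "a \<in> {1, -1}" "b \<in> {1, -1}" "even c"
    "vec x c = vec (pair s a t b) c"
proof -
  from assms consider "(\<Sum>i=1..n. x i * x i) = 1" | "(\<Sum>i=1..n. x i * x i) = 2" "even c"
    unfolding root_coords_def dot_def by metis
  then show ?thesis
  proof cases
    case 1
    show ?thesis
      by (rule norm_one_single [OF finite_atLeastAtMost 1]) (rule short [OF _ _ vec_cong])
  next
    case 2
    show ?thesis
      by (rule norm_two_pair [OF finite_atLeastAtMost 2(1)])
        (rule long [OF _ _ _ _ _ 2(2) vec_cong])
  qed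
qed

lemma D_tw_coords: "D_tw \<epsilon> \<delta> n = {vec x c |x c. root_coords x c}"
proof (intro subset_antisym subsetI)
  fix v assume "v \<in> D_tw \<epsilon> \<delta> n"
  then consider
    a s r where "a \<in> {1, -1}" "s \<in> {1..n}" "v = a *\<^sub>R \<epsilon> s + real_of_int r *\<^sub>R \<delta>" |
    a b s t r where "a \<in> {1, -1}" "b \<in> {1, -1}" "s \<in> {1..n}" "t \<in> {1..n}" "s \<noteq> t"
      "v = a *\<^sub>R \<epsilon> s + b *\<^sub>R \<epsilon> t + real_of_int (2 * r) *\<^sub>R \<delta>"
    unfolding D_tw_def by blast
  then show "v \<in> {vec x c |x c. root_coords x c}"
  proof cases
    case (1 a s r)
    from real_sign_int [OF 1(1)] obtain a' where "a = real_of_int a'" "a' \<in> {1, -1}" .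
    with 1 have "v = vec (single s a') r" "root_coords (single s a') r"
      by (simp_all only: vec_single root_coords_single)
    then show ?thesis by blast
  next
    case (2 a b s t r)
    from real_sign_int [OF 2(1)] obtain a' where a: "a = real_of_int a'" "a' \<in> {1, -1}" .
    from real_sign_int [OF 2(2)] obtain b' where b: "b = real_of_int b'" "b' \<in> {1, -1}" .
    from 2 a b have "v = vec (pair s a' t b') (2 * r)" by (simp only: vec_pair)
    moreover have "root_coords (pair s a' t b') (2 * r)"
      using 2 a b by (intro root_coords_pair) simp_all
    ultimately show ?thesis by blast
  qed
next
  fix v assume "v \<in> {vec x c |x c. root_coords x c}"
  then obtain x c where v: "v = vec x c" "root_coords x c" by blast
  from v(2) show "v \<in> D_tw \<epsilon> \<delta> n"
  proof (cases rule: root_coords_cases)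
    case (short s a)
    have "v = real_of_int a *\<^sub>R \<epsilon> s + real_of_int c *\<^sub>R \<delta>"
      unfolding v(1) short(3) using short(1) by (rule vec_single)
    moreover have "real_of_int a \<in> {1, -1}" using short(2) by auto
    ultimately show ?thesis using short(1) unfolding D_tw_def by blast
  next
    case (long s t a b)
    from \<open>even c\<close> obtain r where r: "c = 2 * r" by (elim evenE)
    have "v = real_of_int a *\<^sub>R \<epsilon> s + real_of_int b *\<^sub>R \<epsilon> t + real_of_int (2 * r) *\<^sub>R \<delta>"
      unfolding v(1) long(7) unfolding r using long(1,2) by (rule vec_pair)
    moreover have "real_of_int a \<in> {1, -1}" "real_of_int b \<in> {1, -1}" using long(4,5) by auto
    ultimately show ?thesis using long(1-3) unfolding D_tw_def by blast
  qed
qed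

lemma vec_in_D_tw_iff: "vec x c \<in> D_tw \<epsilon> \<delta> n \<longleftrightarrow> root_coords x c"
proof
  assume "vec x c \<in> D_tw \<epsilon> \<delta> n"
  then obtain y d where eq: "vec x c = vec y d" and "root_coords y d"
    unfolding D_tw_coords by blast
  moreover have "dot x x = dot y y" using vec_eqD(1) [OF eq] by (intro dot_cong) simp_all
  ultimately show "root_coords x c" using vec_eqD(2) [OF eq] by (simp add: root_coords_def)
qed (auto simp: D_tw_coords)

section \<open>Subsystems cut out by a parity condition\<close>

lemma vec_in_parity_roots_iff:
  "vec x c \<in> parity_roots p J \<longleftrightarrow>
     root_coords x c \<and> even (c - dot p x) \<and> (\<forall>i\<in>{1..n} - J. x i = 0)"
proof
  assume "vec x c \<in> parity_roots p J"
  then obtain y d where eq: "vec x c = vec y d" and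
    y: "root_coords y d" "even (d - dot p y)" "\<forall>i\<in>{1..n} - J. y i = 0"
    unfolding parity_roots_def by blast
  have "dot x x = dot y y" "dot p x = dot p y"
    using vec_eqD(1) [OF eq] by (auto intro: dot_cong)
  with y vec_eqD [OF eq]
  show "root_coords x c \<and> even (c - dot p x) \<and> (\<forall>i\<in>{1..n} - J. x i = 0)"
    by (simp add: root_coords_def)
qed (auto simp: parity_roots_def)

lemma parity_roots_subset: "parity_roots p J \<subseteq> D_tw \<epsilon> \<delta> n"
  unfolding parity_roots_def D_tw_coords by blast

lemma parity_roots_shortI:
  assumes "s \<in> J" "J \<subseteq> {1..n}" "a \<in> {1, -1}" "even (c - p s)"
  shows "vec (single s a) c \<in> parity_roots p J"
proof -
  have s: "s \<in> {1..n}" using assms(1,2) by blast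
  have "even (c - dot p (single s a))" using assms(3,4) by (auto simp: dot_single [OF s])
  moreover have "\<forall>i\<in>{1..n} - J. single s a i = 0" using assms(1) by (auto simp: single_def)
  ultimately show ?thesis
    using root_coords_single [OF s assms(3)] by (simp add: vec_in_parity_roots_iff)
qed

lemma parity_roots_longI:
  assumes "s \<in> J" "t \<in> J" "s \<noteq> t" "J \<subseteq> {1..n}" "a \<in> {1, -1}" "b \<in> {1, -1}" "even c"
    "even (p s - p t)"
  shows "vec (pair s a t b) c \<in> parity_roots p J"
proof -
  have st: "s \<in> {1..n}" "t \<in> {1..n}" using assms(1,2,4) by blast+
  have "dot p (pair s a t b) = a * p s + b * p t"
    by (simp only: dot_add dot_single st)
  with assms(5-8) have "even (c - dot p (pair s a t b))" by auto
  moreover have "\<forall>i\<in>{1..n} - J. pair s a t b i = 0" using assms(1,2) by (auto simp: single_def)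
  moreover have "root_coords (pair s a t b) c" using st assms(3,5-7) by (intro root_coords_pair)
  ultimately show ?thesis unfolding vec_in_parity_roots_iff by (intro conjI)
qed

text \<open>
  The parity condition only sees \<open>p\<close> modulo 2, and signs are odd: for a short root along \<open>\<epsilon>\<^sub>s\<close> it
  compares \<open>c\<close> with \<open>p s\<close>, and for a long root, where \<open>c\<close> is even, it compares \<open>p s\<close> with \<open>p t\<close>.
\<close>

lemma parity_roots_cases:
  assumes "v \<in> parity_roots p J"
  obtains (short) s a c where "s \<in> J" "s \<in> {1..n}" "a \<in> {1, -1}" "even (c - p s)"
      "v = vec (single s a) c"
  | (long) s t a b c where "s \<in> J" "t \<in> J" "s \<in> {1..n}" "t \<in> {1..n}" "s \<noteq> t"
      "a \<in> {1, -1}" "b \<in> {1, -1}" "even c" "even (p s - p t)" "v = vec (pair s a t b) c"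
proof -
  from assms obtain x c where v: "v = vec x c" "root_coords x c"
    unfolding parity_roots_def by blast
  from v(2) show ?thesis
  proof (cases rule: root_coords_cases)
    case (short s a)
    with assms v(1) have "vec (single s a) c \<in> parity_roots p J" by simp
    then have even: "even (c - dot p (single s a))" and "s \<in> J \<or> single s a s = 0"
      using short(1) unfolding vec_in_parity_roots_iff by blast+
    then have "s \<in> J" using short(2) by (auto simp: single_def)
    moreover have "even (c - p s)" using even short(2) unfolding dot_single [OF short(1)] by auto
    ultimately show ?thesis using that(1) [OF _ short(1,2)] short(3) v(1) by simp
  next
    case (long s t a b)
    with assms v(1) have "vec (pair s a t b) c \<in> parity_roots p J" by simp
    then have even: "even (c - dot p (pair s a t b))"
      and zero: "s \<in> J \<or> pair s a t b s = 0" "t \<in> J \<or> pair s a t b t = 0"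
      using long(1,2) unfolding vec_in_parity_roots_iff by blast+
    have "s \<in> J" "t \<in> J" using zero long(3-5) by (auto simp: single_def)
    moreover have "even (p s - p t)"
      using even long(4-6) unfolding dot_add dot_single [OF long(1)] dot_single [OF long(2)] by auto
    ultimately show ?thesis using that(2) [OF _ _ long(1-6)] long(7) v(1) by simp
  qed
qed

text \<open>
  Cartan integers of roots are integers, since the norm of a root is 1 or 2.  The integer \<open>k\<close> is
  characterised by an equation that avoids division.
\<close>

lemma refl_along_vec:
  assumes "root_coords x c"
  obtains k where "refl_along form (vec x c) (vec y d) = vec (\<lambda>i. y i - k * x i) (d - k * c)"
    "k * dot x x = 2 * dot y x"
proof -
  define k where "k = (if dot x x = 1 then 2 * dot y x else dot y x)"
  have k: "k * dot x x = 2 * dot y x" and "dot x x \<noteq> 0"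
    using assms by (auto simp: root_coords_def k_def)
  from k have "real_of_int k * real_of_int (dot x x) = 2 * real_of_int (dot y x)"
    by (metis of_int_mult of_int_numeral)
  then have "cartan_int form (vec y d) (vec x c) = real_of_int k"
    using \<open>dot x x \<noteq> 0\<close> by (simp add: cartan_int_def form_vec divide_eq_eq)
  with that k show ?thesis by (simp add: refl_along_def vec_diff_scaled)
qed

text \<open>
  Reflections preserve the norm.  They also preserve the parity of the coefficient of \<open>\<delta>\<close>, because
  \<open>k c\<close> is even: reflecting in a short root makes \<open>k\<close> even, and for a long one \<open>c\<close> is even.
\<close>

lemma root_coords_reflect:
  assumes "root_coords x c" "root_coords y d" "k * dot x x = 2 * dot y x"
  shows "root_coords (\<lambda>i. y i - k * x i) (d - k * c)"
proof -
  let ?z = "\<lambda>i. y i - k * x i"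
  have "dot ?z ?z = dot y y - k * (2 * dot y x - k * dot x x)"
    by (simp add: dot_diff_scaled dot_commute [of ?z] dot_commute [of x y] algebra_simps)
  with assms(3) have "dot ?z ?z = dot y y" by simp
  moreover have "even (k * c)"
  proof (cases "dot x x = 1")
    case True
    with assms(3) show ?thesis by simp
  next
    case False
    with assms(1) show ?thesis by (simp add: root_coords_def)
  qed
  ultimately show ?thesis using assms(2) by (auto simp: root_coords_def)
qed

lemma parity_roots_reflect:
  assumes "\<alpha> \<in> parity_roots p J" "\<beta> \<in> parity_roots p J"
  shows "refl_along form \<alpha> \<beta> \<in> parity_roots p J"
proof -
  from assms obtain x c y d where \<alpha>\<beta>: "\<alpha> = vec x c" "\<beta> = vec y d"
    and x: "root_coords x c" "even (c - dot p x)" "\<forall>i\<in>{1..n} - J. x i = 0"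
    and y: "root_coords y d" "even (d - dot p y)" "\<forall>i\<in>{1..n} - J. y i = 0"
    unfolding parity_roots_def by blast
  from refl_along_vec [OF x(1), of y d] obtain k
    where k: "refl_along form \<alpha> \<beta> = vec (\<lambda>i. y i - k * x i) (d - k * c)"
      "k * dot x x = 2 * dot y x"
    unfolding \<alpha>\<beta> .
  have "d - k * c - dot p (\<lambda>i. y i - k * x i) = (d - dot p y) - k * (c - dot p x)"
    by (simp add: dot_diff_scaled algebra_simps)
  then have "even (d - k * c - dot p (\<lambda>i. y i - k * x i))"
    using dvd_diff [OF y(2) dvd_mult [OF x(2)]] by (simp only:)
  then show ?thesis
    unfolding k(1) vec_in_parity_roots_iff
    using root_coords_reflect [OF x(1) y(1) k(2)] x(3) y(3) by simp
qed

lemma parity_roots_subroot_system: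
  assumes "s \<in> J" "J \<subseteq> {1..n}"
  shows "subroot_system form (D_tw \<epsilon> \<delta> n) (parity_roots p J)"
proof -
  have "vec (single s 1) (p s) \<in> parity_roots p J"
    using assms by (rule parity_roots_shortI) simp_all
  then show ?thesis
    unfolding subroot_system_def using parity_roots_subset parity_roots_reflect by blast
qed

lemma parity_roots_add:
  assumes "\<alpha> \<in> parity_roots p {1..n}" "\<beta> \<in> parity_roots p {1..n}" "\<alpha> + \<beta> \<in> D_tw \<epsilon> \<delta> n"
  shows "\<alpha> + \<beta> \<in> parity_roots p {1..n}"
proof -
  from assms(1,2) obtain x c y d where \<alpha>\<beta>: "\<alpha> = vec x c" "\<beta> = vec y d"
    and even: "even (c - dot p x)" "even (d - dot p y)"
    unfolding parity_roots_def by blast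
  have "c + d - dot p (\<lambda>i. x i + y i) = (c - dot p x) + (d - dot p y)"
    by (simp add: dot_add)
  then have "even (c + d - dot p (\<lambda>i. x i + y i))"
    using dvd_add [OF even] by (simp only:)
  with assms(3) show ?thesis
    unfolding \<alpha>\<beta> vec_add vec_in_D_tw_iff vec_in_parity_roots_iff by simp
qed

lemma parity_roots_closed:
  assumes "n \<ge> 1"
  shows "closed_subroot_system form (D_tw \<epsilon> \<delta> n) (parity_roots p {1..n})"
  unfolding closed_subroot_system_def
  using parity_roots_subroot_system [of 1 "{1..n}" p] parity_roots_add assms by simp

text \<open>
  One wrong root suffices to generate everything: it yields a wrong short root, which spreads to
  all other indices by adding roots of the subsystem, and from there back to its own index.
\<close>

lemma parity_roots_maximal:
  assumes "n \<ge> 2"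
  shows "maximal_closed_subroot_system form (D_tw \<epsilon> \<delta> n) (parity_roots p {1..n})"
  unfolding maximal_closed_subroot_system_def
proof (intro conjI allI impI)
  let ?\<Phi> = "D_tw \<epsilon> \<delta> n" and ?\<Psi> = "parity_roots p {1..n}"
  show "closed_subroot_system form ?\<Phi> ?\<Psi>"
    using assms by (intro parity_roots_closed) simp
  have one: "1 \<in> {1..n}" using assms by simp
  have "vec (single 1 1) (p 1 + 1) \<in> ?\<Phi>"
    unfolding vec_in_D_tw_iff using one by (rule root_coords_single) simp
  moreover have "vec (single 1 1) (p 1 + 1) \<notin> ?\<Psi>"
    unfolding vec_in_parity_roots_iff dot_single [OF one] by simp
  ultimately show "?\<Psi> \<noteq> ?\<Phi>" by metis
  fix \<Delta> assume \<Delta>: "closed_subroot_system form ?\<Phi> \<Delta> \<and> ?\<Psi> \<subseteq> \<Delta> \<and> \<Delta> \<subset> ?\<Phi>"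
  show "\<Delta> = ?\<Psi>"
  proof (rule ccontr)
    assume "\<Delta> \<noteq> ?\<Psi>"
    with \<Delta> obtain \<beta> where \<beta>: "\<beta> \<in> \<Delta>" "\<beta> \<in> ?\<Phi>" "\<beta> \<notin> ?\<Psi>" by blast
    have short_in: "vec (single s a) c \<in> \<Delta>"
      if "s \<in> {1..n}" "a \<in> {1, -1}" "even (c - p s)" for s a c
      using parity_roots_shortI [of s "{1..n}" a c p, OF that(1) subset_refl that(2,3)] \<Delta> by blast
    have long_in: "vec (pair s a t b) c \<in> \<Delta>"
      if "s \<in> {1..n}" "t \<in> {1..n}" "s \<noteq> t" "a \<in> {1, -1}" "b \<in> {1, -1}" "even c"
        "even (p s - p t)" for s t a b c
      using parity_roots_longI [of s "{1..n}" t a b c p, OF that(1-3) subset_refl that(4-7)] \<Delta>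
      by blast
    have add: "vec z e \<in> \<Delta>"
      if "vec x c \<in> \<Delta>" "vec y d \<in> \<Delta>" "root_coords z e" "\<And>i. z i = x i + y i" "e = c + d"
      for x y z c d e
    proof -
      have eq: "vec z e = vec x c + vec y d" unfolding vec_add that(5) by (rule vec_cong) (rule that(4))
      with that(3) have "vec x c + vec y d \<in> ?\<Phi>" by (simp add: vec_in_D_tw_iff flip: eq)
      with that(1,2) \<Delta> show ?thesis unfolding closed_subroot_system_def eq by blast
    qed
    \<comment> \<open>A wrong long root becomes short by cancelling its \<open>\<epsilon>\<^sub>t\<close> component with a right short root.\<close>
    obtain s a c where s: "s \<in> {1..n}" "a \<in> {1, -1}" "odd (c - p s)" "vec (single s a) c \<in> \<Delta>"
    proof -
      from \<beta>(2) obtain x c where x: "\<beta> = vec x c" "root_coords x c" unfolding D_tw_coords by blast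
      from x(2) show ?thesis
      proof (cases rule: root_coords_cases)
        case (short s a)
        then have eq: "\<beta> = vec (single s a) c" using x(1) by simp
        then have "odd (c - p s)"
          using \<beta>(3) parity_roots_shortI [of s "{1..n}" a c p] short by blast
        with that short eq \<beta>(1) show ?thesis by metis
      next
        case (long s t a b)
        then have eq: "\<beta> = vec (pair s a t b) c" using x(1) by simp
        then have odd: "odd (p s - p t)"
          using \<beta>(3) parity_roots_longI [of s "{1..n}" t a b c p] long(1-6) by blast
        have "vec (single s a) (c + p t) \<in> \<Delta>"
        proof (rule add)
          show "vec (pair s a t b) c \<in> \<Delta>" using \<beta>(1) eq by simp
          show "vec (single t (- b)) (p t) \<in> \<Delta>" using long by (intro short_in) auto
          show "root_coords (single s a) (c + p t)" using long by (intro root_coords_single)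
        qed (simp_all add: single_def)
        moreover have "odd (c + p t - p s)" using odd \<open>even c\<close> by auto
        ultimately show ?thesis using that long(1,4) by metis
      qed
    qed
    \<comment> \<open>If \<open>p s\<close> and \<open>p t\<close> agree modulo 2, a single long root of the subsystem carries index \<open>s\<close> to
      \<open>t\<close>.  Otherwise adding a right short root along \<open>\<epsilon>\<^sub>t\<close> first gives a wrong long root, and then a
      right short root along \<open>\<epsilon>\<^sub>s\<close> cancels the \<open>\<epsilon>\<^sub>s\<close> component.\<close>
    have spread: "vec (single t b) m \<in> \<Delta>"
      if s: "s \<in> {1..n}" "a \<in> {1, -1}" "odd (c - p s)" "vec (single s a) c \<in> \<Delta>"
        and t: "t \<in> {1..n}" "t \<noteq> s" "b \<in> {1, -1}" "odd (m - p t)" for s a c t b m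
    proof (cases "even (p s - p t)")
      case True
      show ?thesis
      proof (rule add [OF s(4)])
        show "vec (pair s (- a) t b) (m - c) \<in> \<Delta>"
          using s t True by (intro long_in) auto
        show "root_coords (single t b) m" using t by (intro root_coords_single)
      qed (simp_all add: single_def)
    next
      case False
      have "vec (pair s a t b) (c + p t) \<in> \<Delta>"
      proof (rule add [OF s(4)])
        show "vec (single t b) (p t) \<in> \<Delta>" using t by (intro short_in) auto
        show "root_coords (pair s a t b) (c + p t)"
          using s t False by (intro root_coords_pair) auto
      qed simp_all
      then show ?thesis
      proof (rule add)
        show "vec (single s (- a)) (m - c - p t) \<in> \<Delta>"
          using s t False by (intro short_in) auto
        show "root_coords (single t b) m" using t by (intro root_coords_single)
      qed (simp_all add: single_def)
    qed
    have all_short: "vec (single t b) m \<in> \<Delta>" if t: "t \<in> {1..n}" "b \<in> {1, -1}" for t b m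
    proof (cases "even (m - p t)")
      case True
      with t show ?thesis by (intro short_in)
    next
      case odd: False
      show ?thesis
      proof (cases "t = s")
        case False
        show ?thesis using s t(1) False t(2) odd by (rule spread)
      next
        case True
        \<comment> \<open>The detour through a second index \<open>u\<close> is where \<open>n \<ge> 2\<close> enters.\<close>
        define u :: nat where "u = (if s = 1 then 2 else 1)"
        have u: "u \<in> {1..n}" "u \<noteq> s" using assms by (auto simp: u_def)
        have wrong: "vec (single u 1) (p u + 1) \<in> \<Delta>"
          using s u by (rule spread) simp_all
        have "t \<noteq> u" using True u(2) by simp
        show ?thesis
          by (rule spread [OF u(1) _ _ wrong t(1) \<open>t \<noteq> u\<close> t(2) odd]) simp_all
      qed
    qed
    have "?\<Phi> \<subseteq> \<Delta>"
    proof
      fix v assume "v \<in> ?\<Phi>"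
      then obtain x c where x: "v = vec x c" "root_coords x c" unfolding D_tw_coords by blast
      from x(2) show "v \<in> \<Delta>"
      proof (cases rule: root_coords_cases)
        case (short s a)
        with x(1) all_short show ?thesis by simp
      next
        case (long s t a b)
        \<comment> \<open>The two short summands may be right or wrong, as all of them have been reached.\<close>
        have "vec (pair s a t b) c \<in> \<Delta>"
        proof (rule add)
          show "vec (single s a) c \<in> \<Delta>" "vec (single t b) 0 \<in> \<Delta>"
            using long by (intro all_short; simp)+
          show "root_coords (pair s a t b) c" using long by (intro root_coords_pair)
        qed simp_all
        then show ?thesis unfolding x(1) long(7) .
      qed
    qed
    with \<Delta> show False by blast
  qed
qed

section \<open>Decomposition into components\<close>

text \<open>
  With \<open>e\<^sub>i = \<epsilon>\<^sub>s + q \<delta>\<close>, the root \<open>\<plusminus> \<epsilon>\<^sub>s + c \<delta>\<close> is \<open>\<plusminus> e\<^sub>i + (c \<minusplus> q) \<delta>\<close>, and the parity condition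
  says precisely that \<open>c \<minusplus> q\<close> is even.  For long roots the shift is \<open>(\<plusminus> 1 \<plusminus> 1) q\<close>, which is always
  even, as is \<open>c\<close>.  Hence the multiples of \<open>2 \<delta>\<close> occur, all of them and no others.
\<close>

lemma parity_roots_eq_B_aff:
  assumes "J \<subseteq> {1..n}" and bij: "bij_betw \<pi> {1..k} J" and const: "\<And>s. s \<in> J \<Longrightarrow> p s = q"
  shows "parity_roots p J = B_aff (\<lambda>i. \<epsilon> (\<pi> i) + real_of_int q *\<^sub>R \<delta>) (2 *\<^sub>R \<delta>) k"
    (is "_ = B_aff ?e ?d k")
proof (intro subset_antisym subsetI)
  have J: "\<pi> i \<in> J" "\<pi> i \<in> {1..n}" if "i \<in> {1..k}" for i
    using bij_betwE [OF bij] that assms(1) by blast+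
  have inj: "\<pi> i \<noteq> \<pi> j" if "i \<in> {1..k}" "j \<in> {1..k}" "i \<noteq> j" for i j
    using bij that unfolding bij_betw_def inj_on_def by metis
  have short: "vec (single (\<pi> i) a) (a * q + 2 * r) = real_of_int a *\<^sub>R ?e i + real_of_int r *\<^sub>R ?d"
    if "i \<in> {1..k}" for i a r
    by (simp add: vec_single [OF J(2) [OF that]] algebra_simps)
  have long: "vec (pair (\<pi> i) a (\<pi> j) b) ((a + b) * q + 2 * r) =
      real_of_int a *\<^sub>R ?e i + real_of_int b *\<^sub>R ?e j + real_of_int r *\<^sub>R ?d"
    if "i \<in> {1..k}" "j \<in> {1..k}" for i j a b r
    by (simp add: vec_pair [OF J(2) [OF that(1)] J(2) [OF that(2)]] algebra_simps)
  have index: "\<exists>i\<in>{1..k}. \<pi> i = s" if "s \<in> J" for s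
    using bij_betw_imp_surj_on [OF bij] that by (metis imageE)
  fix v
  {
    assume "v \<in> parity_roots p J"
    then show "v \<in> B_aff ?e ?d k"
    proof (cases rule: parity_roots_cases)
      case s: (short s a c)
      from index [OF s(1)] obtain i where i: "i \<in> {1..k}" "\<pi> i = s" by blast
      have "even (c - a * q)" using s(3,4) const [OF s(1)] by auto
      then obtain r where "c - a * q = 2 * r" by (elim evenE)
      then have "c = a * q + 2 * r" by simp
      with s(5) i short have v: "v = real_of_int a *\<^sub>R ?e i + real_of_int r *\<^sub>R ?d" by metis
      show ?thesis unfolding v using s(3) i(1) by (intro B_aff_shortI) auto
    next
      case l: (long s t a b c)
      from index [OF l(1)] obtain i where i: "i \<in> {1..k}" "\<pi> i = s" by blast
      from index [OF l(2)] obtain j where j: "j \<in> {1..k}" "\<pi> j = t" by blast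
      have "even (c - (a + b) * q)" using l(6-8) by auto
      then obtain r where "c - (a + b) * q = 2 * r" by (elim evenE)
      then have c: "c = (a + b) * q + 2 * r" by simp
      have v: "v = real_of_int a *\<^sub>R ?e i + real_of_int b *\<^sub>R ?e j + real_of_int r *\<^sub>R ?d"
        unfolding l(10) c i(2) [symmetric] j(2) [symmetric] using i(1) j(1) by (rule long)
      show ?thesis unfolding v using l(5-7) i j by (intro B_aff_longI) auto
    qed
  }
  {
    assume "v \<in> B_aff ?e ?d k"
    then show "v \<in> parity_roots p J"
    proof (cases rule: B_aff_cases)
      case s: (short a i r)
      from real_sign_int [OF s(1)] obtain a' where a: "a = real_of_int a'" "a' \<in> {1, -1}" .
      have v: "v = vec (single (\<pi> i) a') (a' * q + 2 * r)"
        unfolding s(3) a(1) using s(2) by (rule short [symmetric])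
      show ?thesis unfolding v
        using J(1) [OF s(2)] assms(1) a(2)
        by (rule parity_roots_shortI) (use a(2) const [OF J(1) [OF s(2)]] in auto)
    next
      case l: (long a b i j r)
      from real_sign_int [OF l(1)] obtain a' where a: "a = real_of_int a'" "a' \<in> {1, -1}" .
      from real_sign_int [OF l(2)] obtain b' where b: "b = real_of_int b'" "b' \<in> {1, -1}" .
      have v: "v = vec (pair (\<pi> i) a' (\<pi> j) b') ((a' + b') * q + 2 * r)"
        unfolding l(6) a(1) b(1) using l(3,4) by (rule long [symmetric])
      show ?thesis unfolding v
        using J(1) [OF l(3)] J(1) [OF l(4)] inj [OF l(3-5)] assms(1) a(2) b(2)
        by (rule parity_roots_longI)
          (use a(2) b(2) const [OF J(1) [OF l(3)]] const [OF J(1) [OF l(4)]] in auto)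
    qed
  }
qed

lemma parity_roots_component:
  assumes "J \<subseteq> {1..n}" "J \<noteq> {}" and const: "\<And>s. s \<in> J \<Longrightarrow> p s = q"
  shows "irreducible_subroot_system form (D_tw \<epsilon> \<delta> n) (parity_roots p J)"
    and "root_iso form (parity_roots p J) form (B_aff \<epsilon> \<delta> (card J))"
proof -
  have "finite J" using assms(1) by (rule finite_subset) simp
  then obtain \<pi> where bij: "bij_betw \<pi> {1..card J} J"
    using ex_bij_betw_nat_finite_1 by blast
  let ?e = "\<lambda>i. \<epsilon> (\<pi> i) + real_of_int q *\<^sub>R \<delta>" and ?d = "2 *\<^sub>R \<delta>"
  have eq: "parity_roots p J = B_aff ?e ?d (card J)"
    using assms(1) bij const by (rule parity_roots_eq_B_aff)
  have frame': "affine_frame form (card J) ?e ?d"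
    using frame bij assms(1) by (rule affine_frame_rebase) simp
  have "card J \<le> n" using card_mono [OF _ assms(1)] by simp
  then have "{1..card J} \<subseteq> {1..n}" by simp
  from affine_frame_rebase [OF frame bij_betw_id this, of 1 0]
  have "affine_frame form (card J) \<epsilon> \<delta>" by simp
  with frame' show "root_iso form (parity_roots p J) form (B_aff \<epsilon> \<delta> (card J))"
    unfolding eq by (rule root_iso_B_aff)
  from assms(2) obtain s where "s \<in> J" by blast
  then show "irreducible_subroot_system form (D_tw \<epsilon> \<delta> n) (parity_roots p J)"
    unfolding irreducible_subroot_system_def
    using parity_roots_subroot_system [OF _ assms(1)] B_aff_indecomposable [OF frame'] eq
    by metis
qed

lemma parity_roots_orthogonal:
  assumes "J \<inter> K = {}"
  shows "orthogonal_sets form (parity_roots p J) (parity_roots p K)"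
proof -
  have "dot x y = 0"
    if "\<forall>i\<in>{1..n} - J. x i = 0" "\<forall>i\<in>{1..n} - K. y i = 0" for x y
    unfolding dot_def using that assms by (intro sum.neutral) auto
  then show ?thesis
    unfolding orthogonal_sets_def parity_roots_def by (auto simp: form_vec)
qed

lemma Psi_D_tw_eq_parity_roots:
  assumes "I \<subseteq> {1..n}"
  shows "Psi_D_tw \<epsilon> \<delta> n I = parity_roots (\<lambda>s. if s \<in> I then 0 else 1) {1..n}"
    (is "_ = parity_roots ?p _")
proof (intro subset_antisym subsetI)
  fix v assume "v \<in> Psi_D_tw \<epsilon> \<delta> n I"
  then show "v \<in> parity_roots ?p {1..n}"
    unfolding Psi_D_tw_def
  proof (elim UnE CollectE exE conjE)
    fix a s r
    assume on: "a \<in> {1, -1}" "s \<in> I" "v = a *\<^sub>R \<epsilon> s + real_of_int (2 * r) *\<^sub>R \<delta>"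
    from real_sign_int [OF on(1)] obtain a' where a: "a = real_of_int a'" "a' \<in> {1, -1}" .
    have s: "s \<in> {1..n}" using on(2) assms by blast
    have v: "v = vec (single s a') (2 * r)"
      unfolding on(3) a(1) using s by (rule vec_single [symmetric])
    show ?thesis unfolding v
      using s subset_refl a(2) by (rule parity_roots_shortI) (use on(2) in simp)
  next
    fix a s r
    assume off: "a \<in> {1, -1}" "s \<in> {1..n} - I"
      "v = a *\<^sub>R \<epsilon> s + real_of_int (2 * r + 1) *\<^sub>R \<delta>"
    from real_sign_int [OF off(1)] obtain a' where a: "a = real_of_int a'" "a' \<in> {1, -1}" .
    have s: "s \<in> {1..n}" using off(2) by blast
    have v: "v = vec (single s a') (2 * r + 1)"
      unfolding off(3) a(1) using s by (rule vec_single [symmetric])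
    show ?thesis unfolding v
      using s subset_refl a(2) by (rule parity_roots_shortI) (use off(2) in simp)
  next
    fix a b s t r
    assume long: "a \<in> {1, -1}" "b \<in> {1, -1}" "s \<noteq> t"
      "s \<in> I \<and> t \<in> I \<or> s \<in> {1..n} - I \<and> t \<in> {1..n} - I"
      "v = a *\<^sub>R \<epsilon> s + b *\<^sub>R \<epsilon> t + real_of_int (2 * r) *\<^sub>R \<delta>"
    from real_sign_int [OF long(1)] obtain a' where a: "a = real_of_int a'" "a' \<in> {1, -1}" .
    from real_sign_int [OF long(2)] obtain b' where b: "b = real_of_int b'" "b' \<in> {1, -1}" .
    have st: "s \<in> {1..n}" "t \<in> {1..n}" using long(4) assms by blast+
    have v: "v = vec (pair s a' t b') (2 * r)"
      unfolding long(5) a(1) b(1) using st by (rule vec_pair [symmetric])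
    show ?thesis unfolding v
      using st long(3) subset_refl a(2) b(2)
      by (rule parity_roots_longI) (use long(4) in auto)
  qed
next
  fix v assume "v \<in> parity_roots ?p {1..n}"
  then show "v \<in> Psi_D_tw \<epsilon> \<delta> n I"
  proof (cases rule: parity_roots_cases)
    case (short s a c)
    have a: "real_of_int a \<in> {1, -1}" using short(3) by auto
    have v: "v = real_of_int a *\<^sub>R \<epsilon> s + real_of_int c *\<^sub>R \<delta>"
      unfolding short(5) using short(2) by (rule vec_single)
    show ?thesis
    proof (cases "s \<in> I")
      case True
      with short(4) obtain r where "c = 2 * r" by (auto elim: evenE)
      with a v True show ?thesis unfolding Psi_D_tw_def by blast
    next
      case False
      with short(4) have "odd c" by simp
      then obtain r where "c = 2 * r + 1" by (elim oddE)
      moreover have "s \<in> {1..n} - I" using False short(2) by blast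
      ultimately show ?thesis using a v unfolding Psi_D_tw_def by blast
    qed
  next
    case (long s t a b c)
    have ab: "real_of_int a \<in> {1, -1}" "real_of_int b \<in> {1, -1}" using long(6,7) by auto
    obtain r where r: "c = 2 * r" using long(8) by (elim evenE)
    have v: "v = real_of_int a *\<^sub>R \<epsilon> s + real_of_int b *\<^sub>R \<epsilon> t + real_of_int (2 * r) *\<^sub>R \<delta>"
      unfolding long(10) r using long(3,4) by (rule vec_pair)
    have "s \<in> I \<and> t \<in> I \<or> s \<in> {1..n} - I \<and> t \<in> {1..n} - I"
      using long(3,4,9) by (auto split: if_splits)
    with ab v long(5) show ?thesis unfolding Psi_D_tw_def by blast
  qed
qed

text \<open>A long root with one index in \<open>I\<close> and the other outside violates the parity condition.\<close>

lemma parity_roots_split: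
  assumes "I \<subseteq> {1..n}" and p: "p = (\<lambda>s. if s \<in> I then 0 else 1)"
  shows "parity_roots p {1..n} = parity_roots p I \<union> parity_roots p ({1..n} - I)"
proof (intro subset_antisym subsetI)
  fix v assume "v \<in> parity_roots p {1..n}"
  then show "v \<in> parity_roots p I \<union> parity_roots p ({1..n} - I)"
  proof (cases rule: parity_roots_cases)
    case (short s a c)
    show ?thesis
    proof (cases "s \<in> I")
      case True
      then show ?thesis using parity_roots_shortI [of s I a c p, OF True assms(1) short(3,4)] short(5) by simp
    next
      case False
      with short(2) have "s \<in> {1..n} - I" by blast
      then show ?thesis
        using parity_roots_shortI [of s "{1..n} - I" a c p, OF _ Diff_subset short(3,4)] short(5) by simp
    qed
  next
    case (long s t a b c)
    show ?thesis
    proof (cases "s \<in> I")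
      case True
      with long(9) p have "t \<in> I" by (auto split: if_splits)
      then show ?thesis
        using parity_roots_longI [of s I t a b c p, OF True _ long(5) assms(1) long(6-9)] long(10) by simp
    next
      case False
      with long(9) p have "t \<notin> I" by (auto split: if_splits)
      with False long(3,4) have "s \<in> {1..n} - I" "t \<in> {1..n} - I" by blast+
      then show ?thesis
        using parity_roots_longI [of s "{1..n} - I" t a b c p, OF _ _ long(5) Diff_subset long(6-9)] long(10) by simp
    qed
  qed
next
  fix v assume "v \<in> parity_roots p I \<union> parity_roots p ({1..n} - I)"
  then show "v \<in> parity_roots p {1..n}" unfolding parity_roots_def by auto
qed

end

theorem proposition6p1p4:
  fixes form :: "'v::real_vector \<Rightarrow> 'v \<Rightarrow> real"
    and n :: nat and \<epsilon> :: "nat \<Rightarrow> 'v" and \<delta> :: 'v and I :: "nat set"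
  assumes "n \<ge> 2"
    and "affine_frame form n \<epsilon> \<delta>"
    and "I \<subset> {1..n}"
  shows "maximal_closed_subroot_system form (D_tw \<epsilon> \<delta> n) (Psi_D_tw \<epsilon> \<delta> n I) \<and>
         has_B_aff_type form \<epsilon> \<delta> (D_tw \<epsilon> \<delta> n) (Psi_D_tw \<epsilon> \<delta> n I) [card I, n - card I]"
proof
  interpret affine_frame_coords form n \<epsilon> \<delta>
    using assms(2) by unfold_locales
  define p :: "nat \<Rightarrow> int" where "p = (\<lambda>s. if s \<in> I then 0 else 1)"
  define K where "K = {1..n} - I"
  have I: "I \<subseteq> {1..n}" "finite I" using assms(3) by (auto intro: finite_subset)
  have Psi: "Psi_D_tw \<epsilon> \<delta> n I = parity_roots p {1..n}"
    unfolding p_def using I(1) by (rule Psi_D_tw_eq_parity_roots)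
  show "maximal_closed_subroot_system form (D_tw \<epsilon> \<delta> n) (Psi_D_tw \<epsilon> \<delta> n I)"
    unfolding Psi using assms(1) by (rule parity_roots_maximal)
  have K: "K \<subseteq> {1..n}" "K \<noteq> {}" "card K = n - card I"
    using assms(3) card_Diff_subset [OF I(2,1)] by (auto simp: K_def)
  have "finite K" by (simp add: K_def)
  with K have "n - card I \<noteq> 0" by (metis card_eq_0_iff)
  have split: "Psi_D_tw \<epsilon> \<delta> n I = parity_roots p I \<union> parity_roots p K"
    unfolding Psi K_def using I(1) p_def by (rule parity_roots_split)
  have K_component: "irreducible_subroot_system form (D_tw \<epsilon> \<delta> n) (parity_roots p K)"
    "root_iso form (parity_roots p K) form (B_aff \<epsilon> \<delta> (n - card I))"
    unfolding K(3) [symmetric]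
    by (rule parity_roots_component [OF K(1,2), of p 1], simp add: p_def K_def)+
  \<comment> \<open>For empty \<open>I\<close> the summand of rank 0 is dropped, and only one component is left.\<close>
  show "has_B_aff_type form \<epsilon> \<delta> (D_tw \<epsilon> \<delta> n) (Psi_D_tw \<epsilon> \<delta> n I) [card I, n - card I]"
  proof (cases "I = {}")
    case True
    then have "Psi_D_tw \<epsilon> \<delta> n I = parity_roots p K" using Psi by (simp add: K_def)
    with True K_component \<open>n - card I \<noteq> 0\<close> show ?thesis
      unfolding has_B_aff_type_def has_type_def
      by (intro exI [of _ "[parity_roots p K]"]) simp
  next
    case False
    have I_component: "irreducible_subroot_system form (D_tw \<epsilon> \<delta> n) (parity_roots p I)"
      "root_iso form (parity_roots p I) form (B_aff \<epsilon> \<delta> (card I))"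
      by (rule parity_roots_component [OF I(1) False, of p 0], simp add: p_def)+
    have "orthogonal_sets form (parity_roots p I) (parity_roots p K)"
      "orthogonal_sets form (parity_roots p K) (parity_roots p I)"
      by (rule parity_roots_orthogonal, auto simp: K_def)+
    moreover have "card I \<noteq> 0" using False I(2) by simp
    ultimately show ?thesis
      unfolding has_B_aff_type_def has_type_def
      using split K_component I_component \<open>n - card I \<noteq> 0\<close>
      by (intro exI [of _ "[parity_roots p I, parity_roots p K]"])
        (simp add: less_Suc_eq all_conj_distrib)
  qed
qed

end
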